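(* If $A,B\subseteq\mathbb{Z}^+$ are nonempty, then \[\mathrm{Dim}_\zeta(A*B)=\max\{\mathrm{Dim}_\zeta(A),\mathrm{Dim}_\zeta(B)\}\le\mathrm{Dim}_\zeta(A+B)\le\mathrm{Dim}_\zeta(A)+\mathrm{Dim}_\zeta(B).\] Moreover, for all $\alpha,\beta,\gamma\in[0,1]$ with $\max\{\alpha,\beta\}\le\gamma\le\alpha+\beta$, there exist $A,B\subseteq\mathbb{Z}^+$ with $\mathrm{Dim}_\zeta(A)=\alpha$, $\mathrm{Dim}_\zeta(B)=\beta$, and $\mathrm{Dim}_\zeta(A+B)=\gamma$.
   Context: For $A\subseteq\mathbb{Z}^+$, $\mathrm{Dim}_\zeta(A)=\inf\{s\ge0\mid\sum_{n\in A}n^{-s}<\infty\}$. For $A,B\subseteq\mathbb{Z}^+$, $A+B=\{a+b\mid a\in A,b\in B\}$ and $A*B=\{ab\mid a\in A,b\in B\}$. *)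

theory Defs
  imports "HOL-Analysis.Infinite_Sum" "HOL-Library.Set_Algebras"
begin

text \<open>
  Sets of positive integers are rendered as \<open>A :: nat set\<close> with \<open>A \<subseteq> {0<..}\<close>.
  Since the terms are nonnegative, \<open>summable_on\<close> says exactly that the sum is finite.
  For such \<open>A\<close> the set below contains \<open>2\<close> and is bounded below by \<open>0\<close>, so the real
  infimum is the intended one.
\<close>

definition Dim_zeta :: "nat set \<Rightarrow> real" where
  "Dim_zeta A = Inf {s. s \<ge> 0 \<and> (\<lambda>n. real n powr (- s)) summable_on A}"

end

theory Submission
  imports Defs "HOL-Analysis.Summation_Tests"
begin

text \<open>
  The inequalities follow by comparing sums: for \<open>u = s + t\<close> one has
  \<open>(a + b)\<^sup>-\<^sup>u \<le> a\<^sup>-\<^sup>s b\<^sup>-\<^sup>t\<close>, a product that is summable over pairs,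
  while \<open>A * B\<close> and \<open>A + B\<close> contain copies of \<open>A\<close> and of \<open>B\<close> dilated by a bounded factor.

  For the realization, let \<open>N\<close> run through a very fast growing sequence. Near each \<open>N\<close>,
  \<open>A\<close> is an interval of about \<open>N\<^sup>\<alpha>\<close> integers and \<open>B\<close> a progression of about \<open>N\<^sup>\<beta>\<close> integers
  with step about \<open>N\<^bsup>\<gamma> - \<beta>\<^esup>\<close>. As \<open>\<gamma> - \<beta> \<le> \<alpha>\<close>, the interval fills the gaps of the progression, so
  that near \<open>2N\<close> the sumset is essentially an interval of length \<open>N\<^sup>\<gamma>\<close>. Sums of
  elements from different scales number at most \<open>N\<close> to the power \<open>max \<alpha> \<beta> + o(1)\<close>,
  where \<open>N\<close> is the larger scale.
\<close>

section \<open>Convergence exponents\<close>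

text \<open>The map \<open>h\<close> may be far from injective: choosing one preimage for each point
  of \<open>T\<close> turns the claim into reindexing along a bijection. It serves for sums and
  products, which many pairs can share, and for overlapping layers.\<close>

lemma summable_on_image_of_comp:
  fixes f :: "'b \<Rightarrow> real"
  assumes "(f \<circ> h) summable_on S" "T \<subseteq> h ` S"
  shows "f summable_on T"
proof -
  obtain U where U: "U \<subseteq> S" "inj_on h U" "T = h ` U"
    using assms(2) unfolding subset_image_inj by blast
  have "(f \<circ> h) summable_on U"
    using assms(1) U(1) by (rule summable_on_subset_banach)
  then show ?thesis
    using U by (simp add: summable_on_reindex)
qed

lemma Dim_zeta_le:
  assumes "s \<ge> 0" "(\<lambda>n. real n powr (- s)) summable_on A"
  shows "Dim_zeta A \<le> s"
  unfolding Dim_zeta_def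
  by (rule cInf_lower) (use assms in \<open>auto intro!: bdd_belowI[of _ 0]\<close>)

lemma summable_powr_mono:
  assumes "A \<subseteq> {0<..}" "s \<le> t" "(\<lambda>n. real n powr (- s)) summable_on A"
  shows "(\<lambda>n. real n powr (- t)) summable_on A"
  by (rule summable_on_comparison_test[OF assms(3)])
     (use assms in \<open>force intro!: powr_mono\<close>)+

lemma summable_two: "(\<lambda>n. real n powr (- 2)) summable_on A"
proof -
  have "summable (\<lambda>n. real n powr (- 2))"
    by (subst summable_real_powr_iff) simp
  then have "(\<lambda>n. real n powr (- 2)) summable_on UNIV"
    by (subst summable_on_UNIV_nonneg_real_iff) auto
  then show ?thesis
    by (rule summable_on_subset_banach) simp
qed

lemma le_Dim_zeta:
  assumes "\<And>s. s \<ge> 0 \<Longrightarrow> (\<lambda>n. real n powr (- s)) summable_on A \<Longrightarrow> d \<le> s"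
  shows "d \<le> Dim_zeta A"
  unfolding Dim_zeta_def
proof (rule cInf_greatest)
  show "{s. 0 \<le> s \<and> (\<lambda>n. real n powr - s) summable_on A} \<noteq> {}"
    using summable_two[of A] by (auto intro!: exI[of _ 2])
qed (use assms in auto)

lemma Dim_zeta_nonneg: "0 \<le> Dim_zeta A"
  by (rule le_Dim_zeta)

text \<open>On positive integers the admissible exponents are upward closed, so each exponent above
  their infimum is admissible.\<close>

lemma summable_powr_if_Dim_zeta_less:
  assumes "A \<subseteq> {0<..}" "Dim_zeta A < s"
  shows "(\<lambda>n. real n powr (- s)) summable_on A"
proof (rule ccontr)
  assume not_summable: "\<not> ?thesis"
  have "s \<le> Dim_zeta A"
  proof (rule le_Dim_zeta, rule ccontr)
    fix t assume t: "t \<ge> 0" "(\<lambda>n. real n powr (- t)) summable_on A" "\<not> s \<le> t"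
    then show False
      using summable_powr_mono[OF assms(1), of t s] not_summable by simp
  qed
  then show False
    using assms(2) by simp
qed

lemma Dim_zeta_le_if_summable:
  assumes "0 \<le> d" "\<And>s. d < s \<Longrightarrow> (\<lambda>n. real n powr (- s)) summable_on A"
  shows "Dim_zeta A \<le> d"
proof (rule dense_ge)
  fix s assume "d < s"
  then show "Dim_zeta A \<le> s"
    using assms by (intro Dim_zeta_le) auto
qed

text \<open>From \<open>h a\<close> at most c a follows a^(-s) <= c^s (h a)^(-s), so convergence
  over \<open>C\<close> passes back to \<open>A\<close>. It is applied to multiplication by, and
  translation by, a fixed element of the other set.\<close>

lemma Dim_zeta_le_of_dilation:
  fixes c :: real
  assumes "inj_on h A" "h ` A \<subseteq> C" "c > 0"
    and "\<And>a. a \<in> A \<Longrightarrow> 0 < h a \<and> real (h a) \<le> c * real a"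
  shows "Dim_zeta A \<le> Dim_zeta C"
proof (rule le_Dim_zeta)
  fix s :: real
  assume s: "s \<ge> 0" "(\<lambda>n. real n powr (- s)) summable_on C"
  have "(\<lambda>n. real n powr (- s)) summable_on (h ` A)"
    using s(2) assms(2) by (rule summable_on_subset_banach)
  then have "(\<lambda>a. real (h a) powr (- s)) summable_on A"
    using assms(1) by (simp add: summable_on_reindex o_def)
  then have "(\<lambda>a. c powr s * real (h a) powr (- s)) summable_on A"
    by (rule summable_on_cmult_right)
  then have "(\<lambda>a. real a powr (- s)) summable_on A"
  proof (rule summable_on_comparison_test)
    fix a assume "a \<in> A"
    then have h: "0 < real (h a)" "real (h a) \<le> c * real a"
      using assms(4) by auto
    \<comment> \<open>Positivity of a comes from 0 < \<open>h a\<close> <= c a.\<close>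
    then have "0 < c * real a"
      by linarith
    then have a: "0 < real a"
      using assms(3) by (simp add: zero_less_mult_iff)
    have "(c * real a) powr (- s) \<le> real (h a) powr (- s)"
      using h s(1) by (intro powr_mono2') auto
    then have "c powr s * (c powr (- s) * real a powr (- s)) \<le> c powr s * real (h a) powr (- s)"
      using a assms(3) by (intro mult_left_mono) (auto simp: powr_mult)
    then show "real a powr (- s) \<le> c powr s * real (h a) powr (- s)"
      using assms(3) by (simp add: powr_minus field_simps)
  qed auto
  then show "Dim_zeta A \<le> s"
    using s(1) by (intro Dim_zeta_le)
qed

section \<open>Inequalities for product sets and sumsets\<close>

lemma summable_on_product_powr:
  assumes "(\<lambda>n. real n powr (- s)) summable_on A" "(\<lambda>n. real n powr (- t)) summable_on B"
  shows "(\<lambda>(a, b). real a powr (- s) * real b powr (- t)) summable_on A \<times> B"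
proof (rule summable_on_SigmaI)
  fix a
  show "((\<lambda>b. case (a, b) of (a, b) \<Rightarrow> real a powr (- s) * real b powr (- t)) has_sum
      real a powr (- s) * infsum (\<lambda>b. real b powr (- t)) B) B"
    using assms(2) by (auto intro!: has_sum_cmult_right)
next
  show "(\<lambda>a. real a powr (- s) * infsum (\<lambda>b. real b powr (- t)) B) summable_on A"
    using assms(1) by (rule summable_on_cmult_left)
qed auto

text \<open>Since (ab)^(-s) = a^(-s) b^(-s), the sum over pairs factors, and one exponent s above
  both dimensions serves both factors.\<close>

lemma Dim_zeta_times_le:
  assumes "A \<subseteq> {0<..}" "B \<subseteq> {0<..}"
  shows "Dim_zeta (A * B) \<le> max (Dim_zeta A) (Dim_zeta B)"
proof (rule Dim_zeta_le_if_summable)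
  fix s assume "max (Dim_zeta A) (Dim_zeta B) < s"
  then have "(\<lambda>(a, b). real a powr (- s) * real b powr (- s)) summable_on A \<times> B"
    using assms by (intro summable_on_product_powr summable_powr_if_Dim_zeta_less) auto
  then have "((\<lambda>n. real n powr (- s)) \<circ> (\<lambda>(a, b). a * b)) summable_on A \<times> B"
    by (simp add: o_def case_prod_unfold powr_mult)
  then show "(\<lambda>n. real n powr (- s)) summable_on (A * B)"
    by (rule summable_on_image_of_comp) (simp add: set_times_image)
qed (use Dim_zeta_nonneg[of A] in auto)

lemma Dim_zeta_plus_le:
  assumes "A \<subseteq> {0<..}" "B \<subseteq> {0<..}"
  shows "Dim_zeta (A + B) \<le> Dim_zeta A + Dim_zeta B"
proof (rule Dim_zeta_le_if_summable)
  fix u assume u: "Dim_zeta A + Dim_zeta B < u"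
  \<comment> \<open>The excess of u over the two dimensions is halved, so that s and t strictly
    exceed one dimension each while s + t = u.\<close>
  define \<epsilon> where "\<epsilon> = (u - Dim_zeta A - Dim_zeta B) / 2"
  define s where "s = Dim_zeta A + \<epsilon>"
  define t where "t = Dim_zeta B + \<epsilon>"
  have "\<epsilon> > 0" using u by (simp add: \<epsilon>_def)
  then have st: "Dim_zeta A < s" "Dim_zeta B < t"
    by (simp_all add: s_def t_def)
  have nonneg: "0 \<le> s" "0 \<le> t"
    using st Dim_zeta_nonneg[of A] Dim_zeta_nonneg[of B] by linarith+
  have u_eq: "u = s + t" by (simp add: s_def t_def \<epsilon>_def)
  have "(\<lambda>(a, b). real a powr (- s) * real b powr (- t)) summable_on A \<times> B"
    using assms st by (intro summable_on_product_powr summable_powr_if_Dim_zeta_less)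
  then have "((\<lambda>n. real n powr (- u)) \<circ> (\<lambda>(a, b). a + b)) summable_on A \<times> B"
  proof (rule summable_on_comparison_test, goal_cases)
    case (1 p)
    then obtain a b where p: "p = (a, b)" "0 < a" "0 < b"
      using assms by (cases p) auto
    have "real (a + b) powr (- s) * real (a + b) powr (- t)
        \<le> real a powr (- s) * real b powr (- t)"
      using p nonneg by (intro mult_mono powr_mono2') auto
    then show ?case
      using p by (simp add: u_eq flip: powr_add)
  qed auto
  then show "(\<lambda>n. real n powr (- u)) summable_on (A + B)"
    by (rule summable_on_image_of_comp) (simp add: set_plus_image)
qed (use Dim_zeta_nonneg[of A] Dim_zeta_nonneg[of B] in auto)

lemma Dim_zeta_le_times:
  assumes "A \<subseteq> {0<..}" "b \<in> B" "0 < b"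
  shows "Dim_zeta A \<le> Dim_zeta (A * B)"
  by (rule Dim_zeta_le_of_dilation[where h = "\<lambda>a. a * b" and c = "real b"])
     (use assms in \<open>auto intro!: inj_onI set_times_intro simp: set_times_def\<close>)

lemma Dim_zeta_le_plus:
  assumes "A \<subseteq> {0<..}" "b \<in> B"
  shows "Dim_zeta A \<le> Dim_zeta (A + B)"
\<comment> \<open>As a >= 1, a + b <= a + ab = (1 + b) a.\<close>
proof (rule Dim_zeta_le_of_dilation[where h = "\<lambda>a. a + b" and c = "1 + real b"])
  fix a assume "a \<in> A"
  then have "1 \<le> a" using assms(1) by auto
  then have "b * 1 \<le> b * a" by (intro mult_left_mono) auto
  then have "real b \<le> real b * real a"
    by (metis mult.right_neutral of_nat_le_iff of_nat_mult)
  then show "0 < a + b \<and> real (a + b) \<le> (1 + real b) * real a"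
    using \<open>1 \<le> a\<close> by (simp add: algebra_simps)
qed (use assms in \<open>auto intro!: inj_onI set_plus_intro\<close>)

section \<open>Sparse scales\<close>

text \<open>
  Up to a constant, \<open>weight k\<close> bounds the number of elements in all blocks before the
  \<open>k\<close>-th one; \<open>sparse\<close> grows so fast that this is at most \<open>sparse k\<close> to the power \<open>1 / k\<close>.
\<close>

primrec sparse :: "nat \<Rightarrow> nat" where
  "sparse 0 = 1"
| "sparse (Suc k) = (2 ^ Suc k * Suc k * sparse k) ^ Suc k"

primrec weight :: "nat \<Rightarrow> nat" where
  "weight 0 = 1"
| "weight (Suc k) = Suc k * sparse k"

lemma sparse_ge_1: "1 \<le> sparse k"
  by (induction k) (auto simp: Suc_le_eq)

lemma weight_ge_1: "1 \<le> weight k"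
  using sparse_ge_1 by (cases k) (auto simp: Suc_le_eq intro: Suc_leI)

lemma sparse_Suc_ge: "2 ^ Suc k * Suc k * sparse k \<le> sparse (Suc k)"
proof -
  have "1 \<le> 2 ^ Suc k * Suc k * sparse k"
    using sparse_ge_1[of k] by (simp add: Suc_le_eq)
  then have "(2 ^ Suc k * Suc k * sparse k) ^ 1 \<le> (2 ^ Suc k * Suc k * sparse k) ^ Suc k"
    by (intro power_increasing) auto
  then show ?thesis
    by (simp only: power_one_right sparse.simps)
qed

lemma sparse_mono: "j \<le> k \<Longrightarrow> sparse j \<le> sparse k"
proof (induction rule: dec_induct)
  case (step n)
  have "1 * sparse n \<le> (2 ^ Suc n * Suc n) * sparse n"
    by (intro mult_right_mono) (auto simp: Suc_le_eq)
  then show ?case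
    using sparse_Suc_ge[of n] step by linarith
qed auto

lemma two_power_le_sparse: "2 ^ k \<le> sparse k"
proof (cases k)
  case (Suc m)
  have "2 ^ Suc m * 1 \<le> 2 ^ Suc m * (Suc m * sparse m)"
    using sparse_ge_1[of m] by (intro mult_left_mono) (auto simp: Suc_le_eq)
  then show ?thesis
    using sparse_Suc_ge[of m] Suc by (simp only: mult.assoc mult_1_right)
qed auto

text \<open>For k >= 1, \<open>sparse k\<close> is the k-th power of 2^k times
  \<open>weight k\<close>. Hence \<open>weight k\<close> times \<open>sparse k\<close> to the power
  -1/k equals 2^(-k), and once 1/k < \<epsilon> the series is dominated by a geometric one.\<close>

lemma summable_weight_sparse:
  assumes "\<epsilon> > 0"
  shows "summable (\<lambda>k. real (weight k) * real (sparse k) powr (- \<epsilon>))"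
proof (rule summable_comparison_test_ev)
  show "summable (\<lambda>k. (1 / 2 :: real) ^ k)"
    by (intro summable_geometric) auto
  obtain m where m: "inverse (real (Suc m)) < \<epsilon>"
    using reals_Archimedean[OF assms] by auto
  show "\<forall>\<^sub>F k in sequentially.
      norm (real (weight k) * real (sparse k) powr (- \<epsilon>)) \<le> (1 / 2) ^ k"
  proof (rule eventually_sequentiallyI)
    fix k assume "Suc m \<le> k"
    then obtain l where k: "k = Suc l" and l: "m \<le> l"
      by (cases k) auto
    define x where "x = real (2 ^ Suc l * Suc l * sparse l)"
    have x_pos: "x > 0"
      unfolding x_def of_nat_0_less_iff using sparse_ge_1[of l] by simp
    have "inverse (real (Suc l)) \<le> inverse (real (Suc m))"
      using l by (intro le_imp_inverse_le) auto
    then have "- \<epsilon> \<le> - inverse (real (Suc l))"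
      using m by linarith
    then have "real (sparse k) powr (- \<epsilon>) \<le> real (sparse k) powr (- inverse (real (Suc l)))"
      using sparse_ge_1[of k] by (intro powr_mono) auto
    also have "\<dots> = inverse x"
    proof -
      have "real (sparse k) = x powr real (Suc l)"
        using x_pos unfolding x_def k sparse.simps of_nat_power by (simp only: powr_realpow)
      then show ?thesis
        unfolding powr_powr using x_pos by (simp add: powr_powr powr_minus)
    qed
    finally have "real (weight k) * real (sparse k) powr (- \<epsilon>) \<le> real (weight k) * inverse x"
      by (intro mult_left_mono) auto
    also have "\<dots> = (1 / 2) ^ k"
      using x_pos unfolding x_def k by (simp add: field_simps)
    finally show "norm (real (weight k) * real (sparse k) powr (- \<epsilon>)) \<le> (1 / 2) ^ k"
      by simp
  qed
qed

text \<open>With N = \<open>sparse k\<close>, layer k contributes at most its cardinality times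
  N^(-s), hence at most C \<open>weight k\<close> N^(-(s - d)). These bounds are summable for each s
  > d.\<close>

lemma Dim_zeta_le_of_layers:
  fixes C d :: real
  assumes "0 \<le> d" "X \<subseteq> (\<Union>k. S k)"
    and "\<And>k. finite (S k)" "\<And>k. S k \<subseteq> {sparse k..}"
    and card: "\<And>k. real (card (S k)) \<le> C * real (weight k) * real (sparse k) powr d"
  shows "Dim_zeta X \<le> d"
proof (rule Dim_zeta_le_if_summable)
  fix s assume s: "d < s"
  define f where "f = (\<lambda>n. real n powr (- s))"
  have bound: "sum f (S k) \<le> C * (real (weight k) * real (sparse k) powr (- (s - d)))" for k
  proof -
    have "sum f (S k) \<le> (\<Sum>n\<in>S k. real (sparse k) powr (- s))"
      unfolding f_def
    proof (rule sum_mono)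
      fix n assume "n \<in> S k"
      then show "real n powr (- s) \<le> real (sparse k) powr (- s)"
        using assms(1,4) sparse_ge_1[of k] s by (intro powr_mono2') (auto simp: Suc_le_eq)
    qed
    also have "\<dots> = real (card (S k)) * real (sparse k) powr (- s)"
      by simp
    also have "\<dots> \<le> C * real (weight k) * real (sparse k) powr d * real (sparse k) powr (- s)"
      using card by (intro mult_right_mono) auto
    also have "\<dots> = C * (real (weight k) * real (sparse k) powr (- (s - d)))"
      by (simp add: mult.assoc flip: powr_add)
    finally show ?thesis .
  qed
  have "summable (\<lambda>k. C * (real (weight k) * real (sparse k) powr (- (s - d))))"
    using s by (intro summable_mult summable_weight_sparse) auto
  then have "summable (\<lambda>k. sum f (S k))"
    by (rule summable_comparison_test')
       (use bound in \<open>auto simp: f_def abs_of_nonneg sum_nonneg\<close>)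
  then have "(\<lambda>k. sum f (S k)) summable_on UNIV"
    by (subst summable_on_UNIV_nonneg_real_iff) (auto simp: f_def intro: sum_nonneg)
  \<comment> \<open>Layers may overlap, so the sum runs over their disjoint union and is then
    projected to the integers.\<close>
  then have "(f \<circ> snd) summable_on (SIGMA k:UNIV. S k)"
    by (intro summable_on_SigmaI[where g = "\<lambda>k. sum f (S k)"])
       (use assms(3) in \<open>auto simp: f_def intro!: has_sum_finite\<close>)
  then show "(\<lambda>n. real n powr (- s)) summable_on X"
    unfolding f_def[symmetric]
    by (rule summable_on_image_of_comp) (use assms(2) in force)
qed (use assms in auto)

text \<open>Suppose the series converged to M at some s < d. With N = \<open>sparse k\<close>, the
  single layer \<open>F k\<close> already contributes at least c^(-s) N^(d - s), which is unbounded
  in k.\<close>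

lemma le_Dim_zeta_of_layers:
  fixes c d :: real
  assumes "c > 0" and "\<And>k. finite (F k)" "\<And>k. F k \<subseteq> X" "X \<subseteq> {0<..}"
    and le: "\<And>k n. n \<in> F k \<Longrightarrow> real n \<le> c * real (sparse k)"
    and card: "\<And>k. real (sparse k) powr d \<le> real (card (F k))"
  shows "d \<le> Dim_zeta X"
proof (rule le_Dim_zeta, rule ccontr)
  fix s :: real
  assume s: "s \<ge> 0" "(\<lambda>n. real n powr (- s)) summable_on X" "\<not> d \<le> s"
  define M where "M = infsum (\<lambda>n. real n powr (- s)) X"
  have bound: "real (sparse k) powr (d - s) \<le> M * c powr s" for k
  proof -
    have sparse: "0 < real (sparse k)"
      using sparse_ge_1[of k] by simp
    have "real (sparse k) powr d * (c * real (sparse k)) powr (- s)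
        \<le> real (card (F k)) * (c * real (sparse k)) powr (- s)"
      using card by (intro mult_right_mono) auto
    also have "\<dots> = (\<Sum>n\<in>F k. (c * real (sparse k)) powr (- s))"
      by simp
    also have "\<dots> \<le> (\<Sum>n\<in>F k. real n powr (- s))"
    proof (rule sum_mono)
      fix n assume "n \<in> F k"
      then show "(c * real (sparse k)) powr (- s) \<le> real n powr (- s)"
        using le assms(3,4) s(1) by (intro powr_mono2') force+
    qed
    also have "\<dots> \<le> M"
      unfolding M_def using assms s(2) by (intro finite_sum_le_infsum) auto
    finally have "real (sparse k) powr (d - s) * c powr (- s) \<le> M"
      using sparse assms(1) by (simp add: powr_mult powr_diff powr_minus field_simps)
    then show ?thesis
      using assms(1) by (simp add: powr_minus field_simps)
  qed
  define e where "e = d - s"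
  have e: "e > 0" using s(3) by (simp add: e_def)
  \<comment> \<open>The maximum with 1 makes b positive, so the powers 1/e and e cancel; any k above
    b^(1/e) then violates \<open>bound\<close>.\<close>
  define b where "b = max 1 (M * c powr s)"
  obtain k where k: "b powr (1 / e) < real k"
    using reals_Archimedean2 by blast
  have "M * c powr s \<le> (b powr (1 / e)) powr e"
    unfolding powr_powr using e by (simp add: b_def)
  also have "\<dots> < real k powr (d - s)"
    unfolding e_def[symmetric] using e k by (intro powr_less_mono2) auto
  also have "\<dots> \<le> real (sparse k) powr (d - s)"
  proof -
    have "k < 2 ^ k" by (rule less_exp)
    then have "real k \<le> real (sparse k)"
      using two_power_le_sparse[of k] by linarith
    then show ?thesis
      using s(3) by (intro powr_mono2) auto
  qed
  finally show False
    using bound[of k] by simp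
qed

section \<open>Blocks with prescribed exponents\<close>

text \<open>Rounding up preserves the lower bound on cardinalities, and exponent 0 gives exactly
  1.\<close>

definition sparse_pow :: "real \<Rightarrow> nat \<Rightarrow> nat" where
  "sparse_pow a k = nat \<lceil>real (sparse k) powr a\<rceil>"

text \<open>With N = \<open>sparse k\<close>, this is a progression from N with step about
  N^\<delta> and about N^a terms. The case \<delta> = 0 is an interval.\<close>

definition block :: "real \<Rightarrow> real \<Rightarrow> nat \<Rightarrow> nat set" where
  "block \<delta> a k = (\<lambda>y. sparse k + sparse_pow \<delta> k * y) ` {..<sparse_pow a k}"

lemma sparse_pow_ge: "real (sparse k) powr a \<le> real (sparse_pow a k)"
  unfolding sparse_pow_def by (rule real_nat_ceiling_ge)

lemma sparse_powr_ge_1: "0 \<le> a \<Longrightarrow> 1 \<le> real (sparse k) powr a"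
  using sparse_ge_1[of k] by (simp add: ge_one_powr_ge_zero)

text \<open>The power is at least 1, so rounding it up at most doubles it.\<close>

lemma sparse_pow_le:
  assumes "0 \<le> a"
  shows "real (sparse_pow a k) \<le> 2 * real (sparse k) powr a"
  using sparse_powr_ge_1[OF assms, of k] unfolding sparse_pow_def by linarith

lemma sparse_powr_mono: "a \<le> b \<Longrightarrow> real (sparse k) powr a \<le> real (sparse k) powr b"
  using sparse_ge_1[of k] by (intro powr_mono) auto

lemma sparse_pow_mono: "a \<le> b \<Longrightarrow> sparse_pow a k \<le> sparse_pow b k"
  unfolding sparse_pow_def using sparse_powr_mono by (intro nat_mono ceiling_mono)

lemma sparse_pow_pos: "0 < sparse_pow a k"
  using sparse_ge_1[of k] by (simp add: sparse_pow_def Suc_le_eq)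

lemma finite_block: "finite (block \<delta> a k)"
  by (simp add: block_def)

lemma block_ge: "n \<in> block \<delta> a k \<Longrightarrow> sparse k \<le> n"
  by (auto simp: block_def)

lemma UN_block_pos: "(\<Union>k. block \<delta> a k) \<subseteq> {0<..}"
proof
  fix n assume "n \<in> (\<Union>k. block \<delta> a k)"
  then obtain k where "sparse k \<le> n"
    using block_ge by blast
  then show "n \<in> {0<..}"
    using sparse_ge_1[of k] by simp
qed

lemma card_block: "card (block \<delta> a k) = sparse_pow a k"
  unfolding block_def using sparse_pow_pos[of \<delta> k]
  by (subst card_image) (auto intro!: inj_onI)

lemma block_less:
  assumes "0 \<le> \<delta>" "0 \<le> a" "n \<in> block \<delta> a k"
  shows "real n < real (sparse k) + 4 * real (sparse k) powr (\<delta> + a)"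
proof -
  obtain y where y: "n = sparse k + sparse_pow \<delta> k * y" "y < sparse_pow a k"
    using assms(3) by (auto simp: block_def)
  have "real (sparse_pow \<delta> k) * real y < real (sparse_pow \<delta> k) * real (sparse_pow a k)"
    using y(2) sparse_pow_pos[of \<delta> k] by simp
  \<comment> \<open>Rounding costs a factor 2 in the step and another 2 in the length.\<close>
  also have "\<dots> \<le> (2 * real (sparse k) powr \<delta>) * (2 * real (sparse k) powr a)"
    using assms by (intro mult_mono sparse_pow_le) auto
  also have "\<dots> = 4 * real (sparse k) powr (\<delta> + a)"
    by (simp add: powr_add)
  finally show ?thesis
    using y(1) by simp
qed

lemma sparse_powr_le:
  assumes "a \<le> 1"
  shows "real (sparse k) powr a \<le> real (sparse k)"
  using sparse_powr_mono[OF assms, of k] sparse_ge_1[of k] by simp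

lemma block_le:
  assumes "0 \<le> \<delta>" "0 \<le> a" "\<delta> + a \<le> 1" "n \<in> block \<delta> a k"
  shows "real n \<le> 5 * real (sparse k)"
  using block_less[OF assms(1,2,4)] sparse_powr_le[OF assms(3), of k] by linarith

text \<open>For k > 0 there are k earlier blocks, each with at most 2 \<open>sparse (k - 1)\<close>
  elements because a <= 1; their product is twice \<open>weight k\<close>.\<close>

lemma card_UN_blocks_le:
  assumes "0 \<le> a" "a \<le> 1"
  shows "card (\<Union>j<k. block \<delta> a j) \<le> 2 * weight k"
proof (cases k)
  case (Suc m)
  have "card (\<Union>j<k. block \<delta> a j) \<le> (\<Sum>j<k. card (block \<delta> a j))"
    by (rule card_UN_le) simp
  also have "\<dots> \<le> (\<Sum>j<k. 2 * sparse m)"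
  proof (rule sum_mono)
    fix j assume "j \<in> {..<k}"
    then have "sparse j \<le> sparse m"
      using Suc by (intro sparse_mono) auto
    moreover have "real (sparse_pow a j) \<le> 2 * real (sparse j)"
      using sparse_pow_le[OF assms(1), of j] sparse_powr_le[OF assms(2), of j] by linarith
    ultimately show "card (block \<delta> a j) \<le> 2 * sparse m"
      unfolding card_block by linarith
  qed
  finally show ?thesis
    using Suc by (simp add: algebra_simps)
qed simp

lemma card_set_plus_le:
  fixes A B :: "nat set"
  assumes "finite A" "finite B"
  shows "card (A + B) \<le> card A * card B"
  using card_image_le[of "A \<times> B" "\<lambda>(x, y). x + y"] assms
  by (simp add: set_plus_image card_cartesian_product)

text \<open>The blocks themselves serve as layers. As \<delta> + a <= 1, each stays between N and 5N
  for N = \<open>sparse k\<close>, so only its cardinality, of order N^a, determines the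
  dimension.\<close>

lemma Dim_zeta_UN_blocks:
  assumes "0 \<le> \<delta>" "0 \<le> a" "\<delta> + a \<le> 1"
  shows "Dim_zeta (\<Union>k. block \<delta> a k) = a"
proof (rule antisym)
  show "Dim_zeta (\<Union>k. block \<delta> a k) \<le> a"
  proof (rule Dim_zeta_le_of_layers[where S = "block \<delta> a" and C = 2])
    fix k
    have "2 * 1 * real (sparse k) powr a \<le> 2 * real (weight k) * real (sparse k) powr a"
      using weight_ge_1[of k] by (intro mult_right_mono mult_left_mono) auto
    then show "real (card (block \<delta> a k)) \<le> 2 * real (weight k) * real (sparse k) powr a"
      using sparse_pow_le[OF assms(2), of k] unfolding card_block by linarith
  qed (use assms finite_block block_ge in auto)
  show "a \<le> Dim_zeta (\<Union>k. block \<delta> a k)"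
  proof (rule le_Dim_zeta_of_layers[where F = "block \<delta> a" and c = 5])
    show "(\<Union>k. block \<delta> a k) \<subseteq> {0<..}"
      by (rule UN_block_pos)
  qed (use assms block_le sparse_pow_ge in \<open>auto simp: finite_block card_block\<close>)
qed

section \<open>The sumset of intervals and progressions\<close>

context
  fixes \<alpha> \<beta> \<gamma> :: real
  assumes exps: "0 \<le> \<alpha>" "0 \<le> \<beta>" "\<alpha> \<le> \<gamma>" "\<beta> \<le> \<gamma>" "\<gamma> \<le> 1" "\<gamma> \<le> \<alpha> + \<beta>"
begin

text \<open>Multiplying cardinalities would only give exponent \<alpha> + \<beta>. The diameters are
  used instead: with N = \<open>sparse k\<close>, they are below 4N^\<alpha> and 4N^\<gamma>, so the
  sums lie in an interval of length at most 8N^\<gamma>. The extra endpoint raises 8 to 9.\<close>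

lemma card_plus_blocks_le:
  "real (card (block 0 \<alpha> k + block (\<gamma> - \<beta>) \<beta> k)) \<le> 9 * real (sparse k) powr \<gamma>"
proof -
  define L where "L = nat \<lfloor>8 * real (sparse k) powr \<gamma>\<rfloor>"
  have "block 0 \<alpha> k + block (\<gamma> - \<beta>) \<beta> k \<subseteq> {2 * sparse k..2 * sparse k + L}"
  proof
    fix n assume "n \<in> block 0 \<alpha> k + block (\<gamma> - \<beta>) \<beta> k"
    then obtain a b where ab: "n = a + b" "a \<in> block 0 \<alpha> k" "b \<in> block (\<gamma> - \<beta>) \<beta> k"
      by (auto simp: set_plus_def)
    have "real a < real (sparse k) + 4 * real (sparse k) powr \<alpha>"
      using block_less[OF _ _ ab(2)] exps by simp
    moreover have "real b < real (sparse k) + 4 * real (sparse k) powr \<gamma>"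
      using block_less[OF _ _ ab(3)] exps by simp
    moreover have "real (sparse k) powr \<alpha> \<le> real (sparse k) powr \<gamma>"
      using exps by (intro sparse_powr_mono)
    ultimately have "real n \<le> 2 * real (sparse k) + 8 * real (sparse k) powr \<gamma>"
      using ab(1) by simp
    then have "n \<le> 2 * sparse k + L"
      unfolding L_def by linarith
    then show "n \<in> {2 * sparse k..2 * sparse k + L}"
      using block_ge[OF ab(2)] block_ge[OF ab(3)] ab(1) by auto
  qed
  from card_mono[OF _ this] have "card (block 0 \<alpha> k + block (\<gamma> - \<beta>) \<beta> k) \<le> L + 1"
    by simp
  then show ?thesis
    using sparse_powr_ge_1[of \<gamma> k] exps unfolding L_def by linarith
qed

text \<open>Divide the offset from 2 \<open>sparse k\<close> by the step d of the progression: the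
  quotient selects a term of the progression, and the remainder an element of the interval, which is
  long enough since \<gamma> - \<beta> <= \<alpha>.\<close>

lemma interval_subset_plus_blocks:
  "{2 * sparse k..<2 * sparse k + sparse_pow (\<gamma> - \<beta>) k * sparse_pow \<beta> k}
    \<subseteq> block 0 \<alpha> k + block (\<gamma> - \<beta>) \<beta> k"
proof
  define d where "d = sparse_pow (\<gamma> - \<beta>) k"
  fix n assume "n \<in> {2 * sparse k..<2 * sparse k + sparse_pow (\<gamma> - \<beta>) k * sparse_pow \<beta> k}"
  then obtain m where m: "n = 2 * sparse k + m" "m < sparse_pow \<beta> k * d"
    by (auto simp: d_def mult.commute nat_le_iff_add)
  have "m mod d < d"
    using sparse_pow_pos by (simp add: d_def)
  also have "d \<le> sparse_pow \<alpha> k"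
    unfolding d_def using exps by (intro sparse_pow_mono) auto
  finally have "sparse k + m mod d \<in> block 0 \<alpha> k"
    using sparse_ge_1[of k] by (auto simp: block_def sparse_pow_def image_iff)
  moreover have "sparse k + d * (m div d) \<in> block (\<gamma> - \<beta>) \<beta> k"
    using m(2) by (auto simp: block_def d_def less_mult_imp_div_less)
  moreover have "n = (sparse k + m mod d) + (sparse k + d * (m div d))"
    using m(1) by simp
  ultimately show "n \<in> block 0 \<alpha> k + block (\<gamma> - \<beta>) \<beta> k"
    by blast
qed

lemma Dim_zeta_plus_blocks:
  "Dim_zeta ((\<Union>k. block 0 \<alpha> k) + (\<Union>k. block (\<gamma> - \<beta>) \<beta> k)) = \<gamma>"
  (is "Dim_zeta (?A + ?B) = \<gamma>")
proof (rule antisym)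
  \<comment> \<open>Sums are sorted by the larger of their two scale indices: both equal to k, or
    one equal to k and the other smaller.\<close>
  define S where "S = (\<lambda>k. (block 0 \<alpha> k + block (\<gamma> - \<beta>) \<beta> k)
    \<union> (((\<Union>j<k. block 0 \<alpha> j) + block (\<gamma> - \<beta>) \<beta> k)
    \<union> (block 0 \<alpha> k + (\<Union>j<k. block (\<gamma> - \<beta>) \<beta> j))))"
  show "Dim_zeta (?A + ?B) \<le> \<gamma>"
  \<comment> \<open>17 = 9 + 4 + 4: equal scales, then the two kinds of mixed scales.\<close>
  proof (rule Dim_zeta_le_of_layers[where S = S and C = 17])
    show "?A + ?B \<subseteq> (\<Union>k. S k)"
    proof
      fix n assume "n \<in> ?A + ?B"
      then obtain a b i j where n: "n = a + b" "a \<in> block 0 \<alpha> i" "b \<in> block (\<gamma> - \<beta>) \<beta> j"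
        by (auto simp: set_plus_def)
      consider "i = j" | "i < j" | "j < i" by linarith
      then have "n \<in> S (max i j)"
        using n by cases (auto simp: S_def max_def intro!: set_plus_intro)
      then show "n \<in> (\<Union>k. S k)" by blast
    qed
    show "finite (S k)" for k
      by (auto simp: S_def intro!: finite_set_plus finite_block)
    show "S k \<subseteq> {sparse k..}" for k
      by (auto simp: S_def set_plus_def dest!: block_ge)
    show "real (card (S k)) \<le> 17 * real (weight k) * real (sparse k) powr \<gamma>" for k
    proof -
      define x where "x = real (sparse k) powr \<gamma>"
      have pow_le: "real (sparse_pow a k) \<le> 2 * x" if "0 \<le> a" "a \<le> \<gamma>" for a
        using sparse_pow_le[OF that(1), of k] sparse_powr_mono[OF that(2), of k]
        unfolding x_def by linarith
      have 1: "real (card (block 0 \<alpha> k + block (\<gamma> - \<beta>) \<beta> k)) \<le> 9 * x"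
        using card_plus_blocks_le unfolding x_def .
      \<comment> \<open>For mixed scales the product of cardinalities suffices: the earlier blocks
        cost only a factor 2 \<open>weight k\<close>, which the layer criterion tolerates.\<close>
      have "real (card ((\<Union>j<k. block 0 \<alpha> j) + block (\<gamma> - \<beta>) \<beta> k))
          \<le> real (card (\<Union>j<k. block 0 \<alpha> j)) * real (sparse_pow \<beta> k)"
        by (subst card_block[symmetric, where \<delta> = "\<gamma> - \<beta>"], subst of_nat_mult[symmetric], subst of_nat_le_iff)
           (auto intro!: card_set_plus_le finite_block)
      also have "\<dots> \<le> real (2 * weight k) * (2 * x)"
        using exps by (intro mult_mono of_nat_mono card_UN_blocks_le pow_le) auto
      finally have 2: "real (card ((\<Union>j<k. block 0 \<alpha> j) + block (\<gamma> - \<beta>) \<beta> k))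
          \<le> 4 * (real (weight k) * x)" by simp
      have "real (card (block 0 \<alpha> k + (\<Union>j<k. block (\<gamma> - \<beta>) \<beta> j)))
          \<le> real (sparse_pow \<alpha> k) * real (card (\<Union>j<k. block (\<gamma> - \<beta>) \<beta> j))"
        by (subst card_block[symmetric, where \<delta> = 0], subst of_nat_mult[symmetric], subst of_nat_le_iff)
           (auto intro!: card_set_plus_le finite_block)
      also have "\<dots> \<le> (2 * x) * real (2 * weight k)"
        using exps by (intro mult_mono of_nat_mono card_UN_blocks_le pow_le) (auto simp: x_def)
      finally have 3: "real (card (block 0 \<alpha> k + (\<Union>j<k. block (\<gamma> - \<beta>) \<beta> j)))
          \<le> 4 * (real (weight k) * x)" by (simp add: mult.commute)
      have "card (S k) \<le> card (block 0 \<alpha> k + block (\<gamma> - \<beta>) \<beta> k)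
          + (card ((\<Union>j<k. block 0 \<alpha> j) + block (\<gamma> - \<beta>) \<beta> k)
          + card (block 0 \<alpha> k + (\<Union>j<k. block (\<gamma> - \<beta>) \<beta> j)))"
        unfolding S_def by (meson add_left_mono card_Un_le order_trans)
      moreover have "1 * x \<le> real (weight k) * x"
        using weight_ge_1[of k] by (intro mult_right_mono) (auto simp: x_def)
      ultimately show ?thesis
        using 1 2 3 unfolding x_def[symmetric] by linarith
    qed
  qed (use exps in auto)
  show "\<gamma> \<le> Dim_zeta (?A + ?B)"
  \<comment> \<open>Both summands are at most 5 \<open>sparse k\<close>. Sums at equal scales alone
    give the lower bound, through the interval they contain.\<close>
  proof (rule le_Dim_zeta_of_layers[where c = 10
        and F = "\<lambda>k. block 0 \<alpha> k + block (\<gamma> - \<beta>) \<beta> k"])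
    show "?A + ?B \<subseteq> {0<..}"
      using UN_block_pos[of 0 \<alpha>] UN_block_pos[of "\<gamma> - \<beta>" \<beta>]
      by (fastforce simp: set_plus_def)
    show "real n \<le> 10 * real (sparse k)" if "n \<in> block 0 \<alpha> k + block (\<gamma> - \<beta>) \<beta> k" for n k
    proof -
      obtain a b where ab: "n = a + b" "a \<in> block 0 \<alpha> k" "b \<in> block (\<gamma> - \<beta>) \<beta> k"
        using \<open>n \<in> _\<close> by (auto simp: set_plus_def)
      then show ?thesis
        using block_le[OF _ _ _ ab(2)] block_le[OF _ _ _ ab(3)] exps by simp
    qed
    show "real (sparse k) powr \<gamma> \<le> real (card (block 0 \<alpha> k + block (\<gamma> - \<beta>) \<beta> k))" for k
    proof -
      have "real (sparse k) powr \<gamma> = real (sparse k) powr (\<gamma> - \<beta>) * real (sparse k) powr \<beta>"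
        by (simp flip: powr_add)
      also have "\<dots> \<le> real (sparse_pow (\<gamma> - \<beta>) k) * real (sparse_pow \<beta> k)"
        by (intro mult_mono sparse_pow_ge) auto
      also have "\<dots> \<le> real (card (block 0 \<alpha> k + block (\<gamma> - \<beta>) \<beta> k))"
        using card_mono[OF _ interval_subset_plus_blocks[of k]]
        by (simp add: finite_set_plus finite_block flip: of_nat_mult)
      finally show ?thesis .
    qed
    show "block 0 \<alpha> k + block (\<gamma> - \<beta>) \<beta> k \<subseteq> ?A + ?B" for k
      by (intro set_plus_mono2) auto
  qed (auto intro: finite_set_plus finite_block)
qed

end

theorem theorem5p6:
  shows "(\<forall>A B :: nat set. A \<subseteq> {0<..} \<longrightarrow> B \<subseteq> {0<..} \<longrightarrow> A \<noteq> {} \<longrightarrow> B \<noteq> {} \<longrightarrow>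
            Dim_zeta (A * B) = max (Dim_zeta A) (Dim_zeta B) \<and>
            max (Dim_zeta A) (Dim_zeta B) \<le> Dim_zeta (A + B) \<and>
            Dim_zeta (A + B) \<le> Dim_zeta A + Dim_zeta B) \<and>
         (\<forall>\<alpha> \<beta> \<gamma> :: real. \<alpha> \<in> {0..1} \<longrightarrow> \<beta> \<in> {0..1} \<longrightarrow> \<gamma> \<in> {0..1} \<longrightarrow>
            max \<alpha> \<beta> \<le> \<gamma> \<longrightarrow> \<gamma> \<le> \<alpha> + \<beta> \<longrightarrow>
            (\<exists>A B :: nat set. A \<subseteq> {0<..} \<and> B \<subseteq> {0<..} \<and>
               Dim_zeta A = \<alpha> \<and> Dim_zeta B = \<beta> \<and> Dim_zeta (A + B) = \<gamma>))"
proof (intro conjI allI impI)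
  fix A B :: "nat set"
  assume *: "A \<subseteq> {0<..}" "B \<subseteq> {0<..}" "A \<noteq> {}" "B \<noteq> {}"
  then obtain a b where ab: "a \<in> A" "b \<in> B" "0 < a" "0 < b"
    by auto
  have "Dim_zeta B \<le> Dim_zeta (A * B)"
    using Dim_zeta_le_times[of B a A] * ab by (simp add: mult.commute)
  then show "Dim_zeta (A * B) = max (Dim_zeta A) (Dim_zeta B)"
    using Dim_zeta_times_le[of A B] Dim_zeta_le_times[of A b B] * ab by simp
  have "Dim_zeta B \<le> Dim_zeta (A + B)"
    using Dim_zeta_le_plus[of B a A] * ab by (simp add: add.commute)
  then show "max (Dim_zeta A) (Dim_zeta B) \<le> Dim_zeta (A + B)"
    using Dim_zeta_le_plus[of A b B] * ab by simp
  show "Dim_zeta (A + B) \<le> Dim_zeta A + Dim_zeta B"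
    using * by (intro Dim_zeta_plus_le)
next
  fix \<alpha> \<beta> \<gamma> :: real
  assume *: "\<alpha> \<in> {0..1}" "\<beta> \<in> {0..1}" "\<gamma> \<in> {0..1}" "max \<alpha> \<beta> \<le> \<gamma>" "\<gamma> \<le> \<alpha> + \<beta>"
  show "\<exists>A B :: nat set. A \<subseteq> {0<..} \<and> B \<subseteq> {0<..} \<and>
      Dim_zeta A = \<alpha> \<and> Dim_zeta B = \<beta> \<and> Dim_zeta (A + B) = \<gamma>"
    \<comment> \<open>The span exponents of the two families are \<alpha> and (\<gamma> - \<beta>) +
      \<beta> = \<gamma>, both at most 1, as \<open>Dim_zeta_UN_blocks\<close> requires.\<close>
    by (rule exI[of _ "\<Union>k. block 0 \<alpha> k"], rule exI[of _ "\<Union>k. block (\<gamma> - \<beta>) \<beta> k"])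
       (use * UN_block_pos in \<open>auto simp: Dim_zeta_UN_blocks Dim_zeta_plus_blocks\<close>)
qed

end
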